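(* For every integer $b\ge 2$ and every integer $n\ge 2$, $$\frac b2\ln\Big(\frac n{2b}+1\Big)< k_{\min}(b,n)\le \min\{\lceil 2b\ln n\rceil,n\}.$$
   Context: For positive integers $b,k$ and $n$, the $(1:b)$ Painter-Builder $k$-colouring game on $[n]=\{1,\dots,n\}$ is played between Painter (moving first) and Builder, alternating turns. The game graph has vertex set $[n]$, initially no edges, all vertices uncoloured. In each round Painter colours exactly one previously uncoloured vertex with one of $k$ colours, and then Builder adds exactly $b$ new edges (pairs of previously non-adjacent vertices); if fewer than $b$ unselected pairs remain, Builder selects all of them and Painter colours as many vertices as possible, and the game ends. Both players must keep the game graph properly coloured (no edge joins two vertices of the same colour); if Painter cannot colour any uncoloured vertex legally (some uncoloured vertex has neighbours of all $k$ colours) the game ends. Painter wins if and only if at the end of the game all $n$ vertices are properly coloured. $k_{\min}(b,n)$ denotes the minimum number of colours $k$ such that Painter has a winning strategy in the $(1:b)$ Painter-Builder $k$-colouring game on $[n]$. *)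

theory Defs
  imports Complex_Main
begin

text \<open>
  A position consists of the partial colouring and the edge set of the game graph on
  \<open>{1..n}\<close>; uncoloured vertices are mapped to \<^const>\<open>None\<close>, edges are two-element sets.
\<close>

type_synonym colouring = "nat \<Rightarrow> nat option"
type_synonym graph = "nat set set"
type_synonym position = "colouring \<times> graph"

definition proper :: "colouring \<Rightarrow> graph \<Rightarrow> bool" where
  "proper c E \<longleftrightarrow> (\<forall>u v. {u, v} \<in> E \<and> c u \<noteq> None \<longrightarrow> c u \<noteq> c v)"

definition fully_coloured :: "nat \<Rightarrow> nat \<Rightarrow> colouring \<Rightarrow> bool" where
  "fully_coloured k n c \<longleftrightarrow> (\<forall>v\<in>{1..n}. \<exists>i\<in>{1..k}. c v = Some i)"

definition painter_legal :: "nat \<Rightarrow> nat \<Rightarrow> position \<Rightarrow> nat \<times> nat \<Rightarrow> bool" where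
  "painter_legal k n = (\<lambda>(c, E) (v, i).
     v \<in> {1..n} \<and> c v = None \<and> i \<in> {1..k} \<and> proper (c(v \<mapsto> i)) E)"

definition paint :: "position \<Rightarrow> nat \<times> nat \<Rightarrow> position" where
  "paint = (\<lambda>(c, E) (v, i). (c(v \<mapsto> i), E))"

text \<open>
  The pairs Builder may still select: those that are not edges yet and whose end vertices do
  not carry the same colour.
\<close>

definition available :: "nat \<Rightarrow> position \<Rightarrow> graph" where
  "available n = (\<lambda>(c, E). {{u, v} | u v. u \<in> {1..n} \<and> v \<in> {1..n} \<and> u \<noteq> v \<and>
     {u, v} \<notin> E \<and> \<not> (c u \<noteq> None \<and> c u = c v)})"

definition build :: "position \<Rightarrow> graph \<Rightarrow> position" where
  "build = (\<lambda>(c, E) F. (c, E \<union> F))"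

definition builder_legal :: "nat \<Rightarrow> nat \<Rightarrow> position \<Rightarrow> graph \<Rightarrow> bool" where
  "builder_legal b n p F \<longleftrightarrow> F \<subseteq> available n p \<and> card F = b"

definition completable :: "nat \<Rightarrow> nat \<Rightarrow> position \<Rightarrow> bool" where
  "completable k n = (\<lambda>(c, E). \<exists>c'. c \<subseteq>\<^sub>m c' \<and> fully_coloured k n c' \<and> proper c' E)"

text \<open>
  A strategy of Painter may depend on the whole history, i.e. on the list of all positions in
  which it was Painter's turn, the current one first. It returns a vertex and its colour.
\<close>

type_synonym strategy = "position list \<Rightarrow> nat \<times> nat"

text \<open>
  Histories of complete rounds in which Painter follows \<open>\<sigma>\<close> while Builder plays arbitrarily.
  There is no such round if fewer than \<open>b\<close> pairs are available to Builder; that final turn is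
  treated in \<open>winning_strategy\<close>.
\<close>

inductive consistent :: "nat \<Rightarrow> nat \<Rightarrow> nat \<Rightarrow> strategy \<Rightarrow> position list \<Rightarrow> bool"
  for b k n :: nat and \<sigma> :: strategy where
  start: "consistent b k n \<sigma> [(\<lambda>_. None, {})]"
| round: "consistent b k n \<sigma> (p # h) \<Longrightarrow> painter_legal k n p (\<sigma> (p # h)) \<Longrightarrow>
    q = paint p (\<sigma> (p # h)) \<Longrightarrow> builder_legal b n q F \<Longrightarrow>
    consistent b k n \<sigma> (build q F # p # h)"

text \<open>
  Whenever it is Painter's turn and some vertex is uncoloured, the strategy has to provide a
  legal move. If Builder then has fewer than \<open>b\<close> pairs available, he selects all of them and
  the game ends with Painter colouring as many vertices as possible, so she wins iff the
  colouring can be completed. As each round colours a vertex, every play is finite.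
\<close>

definition winning_strategy :: "nat \<Rightarrow> nat \<Rightarrow> nat \<Rightarrow> strategy \<Rightarrow> bool" where
  "winning_strategy b k n \<sigma> \<longleftrightarrow>
     (\<forall>p h. consistent b k n \<sigma> (p # h) \<and> \<not> fully_coloured k n (fst p) \<longrightarrow>
        painter_legal k n p (\<sigma> (p # h)) \<and>
        (let q = paint p (\<sigma> (p # h)) in
           card (available n q) < b \<longrightarrow> completable k n (build q (available n q))))"

definition k_min :: "nat \<Rightarrow> nat \<Rightarrow> nat" where
  "k_min b n = (LEAST k. 0 < k \<and> (\<exists>\<sigma>. winning_strategy b k n \<sigma>))"

end

theory Submission
  imports Defs "HOL-Analysis.Harmonic_Numbers"
begin

text \<open>
  Upper bound: Painter always colours an uncoloured vertex of maximum degree, with any legal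
  colour. As in the box game, the average degree of a set of \<open>j + 1\<close> uncoloured vertices that
  contains the painted one bounds the average over the remaining \<open>j\<close> vertices, and Builder
  raises the latter by at most \<open>2 b / j\<close>, by \<open>b\<close> if \<open>j = 1\<close>, and by \<open>(b + 1) / 2\<close> if \<open>j = 2\<close>.
  Hence the degree of every uncoloured vertex stays at most \<open>2 b H\<^sub>n\<^sub>-\<^sub>1 - 3 b / 2 + 1 / 2\<close>,
  if \<open>n \<ge> 3\<close>, which is less than \<open>2 b ln n\<close> because Euler's constant is less than \<open>5 / 8\<close>. It also is at
  most \<open>n - 1\<close>.

  Lower bound: Builder plays in phases. At the beginning of a phase all \<open>m\<close> uncoloured vertices
  see the same \<open>j\<close> colours, so Painter has to use a new colour \<open>c\<close>, and Builder spends about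
  \<open>m / b\<close> rounds on joining all uncoloured vertices to colour \<open>c\<close>. Thus \<open>m + 2 b\<close> shrinks at most
  by the factor \<open>1 - 1 / b \<ge> exp (- 2 / b)\<close> per phase, and if it exceeds \<open>2 b\<close> after \<open>k\<close> phases,
  then an uncoloured vertex sees all \<open>k\<close> colours.
\<close>

section \<open>Uncoloured vertices, edges and degrees\<close>

definition uncoloured :: "nat \<Rightarrow> colouring \<Rightarrow> nat set" where
  "uncoloured n c = {v \<in> {1..n}. c v = None}"

definition pairs :: "nat \<Rightarrow> graph" where
  "pairs n = {{u, v} | u v. u \<in> {1..n} \<and> v \<in> {1..n} \<and> u \<noteq> v}"

definition degree :: "graph \<Rightarrow> nat \<Rightarrow> nat" where
  "degree E v = card {e \<in> E. v \<in> e}"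

lemma finite_uncoloured [simp]: "finite (uncoloured n c)"
  by (simp add: uncoloured_def)

lemma finite_pairs: "finite (pairs n)"
  by (rule finite_subset[of _ "Pow {1..n}"]) (auto simp: pairs_def)

lemma card_pair: "e \<in> pairs n \<Longrightarrow> card e = 2"
  by (auto simp: pairs_def)

lemma available_subset_pairs: "available n q \<subseteq> pairs n"
  by (auto simp: available_def pairs_def split: prod.splits)

lemma finite_available: "finite (available n q)"
  using finite_subset[OF available_subset_pairs finite_pairs] .

lemma uncoloured_paint: "uncoloured n (c(v \<mapsto> i)) = uncoloured n c - {v}"
  by (auto simp: uncoloured_def)

lemma not_fully_coloured: "uncoloured n c \<noteq> {} \<Longrightarrow> \<not> fully_coloured k n c"
  by (force simp: uncoloured_def fully_coloured_def)

lemma proper_build: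
  assumes "proper c E" "F \<subseteq> available n (c, E)"
  shows "proper c (E \<union> F)"
  unfolding proper_def
proof (intro allI impI, elim conjE)
  fix u v assume uv: "{u, v} \<in> E \<union> F" and u: "c u \<noteq> None"
  show "c u \<noteq> c v"
  proof (cases "{u, v} \<in> E")
    case True
    then show ?thesis using assms(1) u unfolding proper_def by blast
  next
    case False
    with uv assms(2) have "{u, v} \<in> available n (c, E)" by blast
    then obtain x y where "{u, v} = {x, y}" "\<not> (c x \<noteq> None \<and> c x = c y)"
      by (auto simp: available_def)
    then show ?thesis using u by (auto simp: doubleton_eq_iff)
  qed
qed

subsection \<open>Painter's strategy\<close>

lemma sum_degree:
  assumes "finite F" "finite S"
  shows "(\<Sum>v\<in>S. degree F v) = (\<Sum>e\<in>F. card (e \<inter> S))"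
proof -
  have "(\<Sum>v\<in>S. degree F v) = (\<Sum>v\<in>S. \<Sum>e\<in>F. if v \<in> e then 1 else 0)"
    using assms by (simp add: degree_def sum.If_cases Int_def)
  also have "\<dots> = (\<Sum>e\<in>F. \<Sum>v\<in>S. if v \<in> e then 1 else 0)"
    by (rule sum.swap)
  also have "\<dots> = (\<Sum>e\<in>F. card (e \<inter> S))"
    using assms by (intro sum.cong refl) (simp add: sum.If_cases Int_def conj_commute)
  finally show ?thesis .
qed

text \<open>An edge has at most two ends in a set of \<open>i\<close> vertices, at most one if
  \<open>i = 1\<close>, and both ends in a two-element set only if it equals that set.\<close>

definition gain :: "nat \<Rightarrow> nat \<Rightarrow> nat" where
  "gain b i = (if i = 1 then b else if i = 2 then b + 1 else 2 * b)"

text \<open>For two vertices the bound uses that at most one of the new edges joins them.\<close>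

lemma sum_degree_le_gain:
  assumes F: "F \<subseteq> pairs n" "card F \<le> b" and S: "finite S"
  shows "(\<Sum>v\<in>S. degree F v) \<le> gain b (card S)"
proof -
  have fF: "finite F" using F(1) finite_pairs finite_subset by blast
  have le: "card (e \<inter> S) \<le> 2" "card (e \<inter> S) \<le> card S" if "e \<in> F" for e
  proof -
    have "card e = 2" using that F card_pair by blast
    then show "card (e \<inter> S) \<le> 2" by (metis Int_lower1 card.infinite card_mono zero_neq_numeral)
    show "card (e \<inter> S) \<le> card S" using S by (intro card_mono) auto
  qed
  have sum_le: "(\<Sum>e\<in>F. card (e \<inter> S)) \<le> m * b" if "\<And>e. e \<in> F \<Longrightarrow> card (e \<inter> S) \<le> m" for m
  proof -
    have "(\<Sum>e\<in>F. card (e \<inter> S)) \<le> card F * m"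
      using sum_bounded_above[of F "\<lambda>e. card (e \<inter> S)" m] that by simp
    also have "\<dots> \<le> m * b" using F(2) by simp
    finally show ?thesis .
  qed
  consider "card S = 1" | "card S = 2" | "card S \<noteq> 1" "card S \<noteq> 2" by blast
  then show ?thesis
  proof cases
    case 1
    then show ?thesis using sum_le[of 1] le by (simp add: sum_degree fF S gain_def)
  next
    case 2
    have "(\<Sum>e\<in>F. card (e \<inter> S)) \<le> (\<Sum>e\<in>F. 1 + (if e = S then 1 else 0))"
    proof (rule sum_mono)
      fix e assume e: "e \<in> F"
      have "card (e \<inter> S) \<noteq> 2" if "e \<noteq> S"
      proof
        assume a: "card (e \<inter> S) = 2"
        have ce: "card e = 2" using e F card_pair by blast
        then have "finite e" using card.infinite by fastforce
        then have "e \<inter> S = e" "e \<inter> S = S"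
          using a ce 2 S by (simp_all add: card_subset_eq)
        then show False using that by blast
      qed
      then show "card (e \<inter> S) \<le> 1 + (if e = S then 1 else 0)"
        using le(1)[OF e] by (cases "e = S") auto
    qed
    also have "\<dots> \<le> card F + 1" unfolding sum.distrib using fF by simp
    finally show ?thesis using 2 F(2) by (simp add: sum_degree fF S gain_def)
  next
    case 3
    then show ?thesis using sum_le[of 2] le by (simp add: sum_degree fF S gain_def)
  qed
qed

lemma degree_Un_le: "degree (E \<union> F) v \<le> degree E v + degree F v"
proof -
  have "{e \<in> E \<union> F. v \<in> e} = {e \<in> E. v \<in> e} \<union> {e \<in> F. v \<in> e}" by blast
  then show ?thesis by (simp add: degree_def card_Un_le)
qed

lemma degree_less:
  assumes "E \<subseteq> pairs n" "v \<in> {1..n}"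
  shows "degree E v < n"
proof -
  have "{e \<in> E. v \<in> e} \<subseteq> (\<lambda>w. {v, w}) ` ({1..n} - {v})"
  proof
    fix e assume e: "e \<in> {e \<in> E. v \<in> e}"
    then have "e \<in> pairs n" using assms(1) by blast
    then obtain x y where "e = {x, y}" "x \<in> {1..n}" "y \<in> {1..n}" "x \<noteq> y"
      unfolding pairs_def by blast
    then show "e \<in> (\<lambda>w. {v, w}) ` ({1..n} - {v})" using e by auto
  qed
  then have "degree E v \<le> card ({1..n} - {v})"
    unfolding degree_def by (meson card_image_le card_mono finite_Diff finite_atLeastAtMost
        finite_imageI le_trans)
  also have "\<dots> < n" using assms(2) by simp
  finally show ?thesis .
qed

section \<open>Average degrees and harmonic numbers\<close>

definition avg_bound :: "nat \<Rightarrow> nat \<Rightarrow> nat \<Rightarrow> real" where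
  "avg_bound b n j = (\<Sum>i=j..<n. real (gain b i) / real i)"

text \<open>Read from right to left, this is the recursion of the game: passing from
  \<open>Suc j\<close> to \<open>j\<close> uncoloured vertices raises the bound on the average by
  \<open>gain b j / j\<close>, the contribution of one turn of Builder.\<close>

lemma avg_bound_Suc:
  "j < n \<Longrightarrow> avg_bound b n j = real (gain b j) / real j + avg_bound b n (Suc j)"
  by (simp add: avg_bound_def sum.atLeast_Suc_lessThan)

lemma avg_bound_nonneg: "avg_bound b n j \<ge> 0"
  by (simp add: avg_bound_def sum_nonneg)

lemma harm_less: "harm (Suc m) < ln (real (m + 2)) + 5 / 8"
proof -
  have "harm (Suc m) - ln (real (m + 2)) + 1 / real (2 * (m + 2)) \<le> euler_mascheroni"
    using euler_mascheroni_lower[of m] by simp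
  moreover have "0 < 1 / real (2 * (m + 2))" by simp
  ultimately show ?thesis using euler_mascheroni_less_13_over_22 by linarith
qed

lemma avg_bound_less:
  assumes "b \<ge> 2" "n \<ge> 2"
  shows "avg_bound b n 1 < 2 * real b * ln (real n)"
proof (cases "n = 2")
  case True
  have "avg_bound b n 1 = real b" by (simp add: True avg_bound_def gain_def numeral_2_eq_2)
  also have "\<dots> < 2 * real b * ln 2" using ln2_ge_two_thirds assms by simp
  finally show ?thesis using True by simp
next
  case False
  define m where "m = n - 2"
  have n: "n = m + 2" "m \<ge> 1" using False assms by (auto simp: m_def)
  have split: "(\<Sum>i=1..<n. f i) = f 1 + f 2 + (\<Sum>i=3..<n. f i)" for f :: "nat \<Rightarrow> real"
  proof -
    have "{1..<n} = insert 1 (insert 2 {3..<n})" using n by auto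
    then show ?thesis by simp
  qed
  have "(\<Sum>i=3..<n. real (gain b i) / real i) = (\<Sum>i=3..<n. 2 * real b * inverse (real i))"
    by (intro sum.cong) (auto simp: gain_def field_simps)
  then have F: "avg_bound b n 1 = b + (b + 1) / 2 + 2 * b * (\<Sum>i=3..<n. inverse (real i))"
    unfolding avg_bound_def split by (simp add: gain_def sum_distrib_left)
  have "harm (Suc m) = (\<Sum>i=1..<n. inverse (real i))"
    by (simp add: harm_def n atLeastLessThanSuc_atLeastAtMost)
  also have "\<dots> = 3 / 2 + (\<Sum>i=3..<n. inverse (real i))"
    unfolding split by simp
  \<comment> \<open>The constant is \<open>7 / 8 = 3 / 2 - 5 / 8\<close>, where \<open>3 / 2\<close>
    comes from the terms for 1 and 2.\<close>
  finally have h: "(\<Sum>i=3..<n. inverse (real i)) < ln (real n) - 7 / 8"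
    using harm_less[of m] n by simp
  have "2 * b * (\<Sum>i=3..<n. inverse (real i)) < 2 * b * (ln (real n) - 7 / 8)"
    using h assms by simp
  \<comment> \<open>Equality holds at \<open>b = 2\<close>: the smaller gains for one and two
    vertices just compensate for the estimate \<open>5 / 8\<close> of Euler's constant.\<close>
  moreover have "real b + real (b + 1) / 2 \<le> 7 / 4 * real b"
    using assms by (simp add: field_simps)
  moreover have "2 * b * (ln (real n) - 7 / 8) = 2 * real b * ln (real n) - 7 / 4 * real b"
    by (simp add: algebra_simps)
  ultimately show ?thesis using F by linarith
qed

text \<open>All sets are considered, not only the set of all uncoloured vertices, because the bound
  for \<open>S\<close> after a round comes from \<open>insert v S\<close> before it. Singletons
  bound the single degrees.\<close>

definition balanced :: "nat \<Rightarrow> nat \<Rightarrow> position \<Rightarrow> bool" where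
  "balanced b n = (\<lambda>(c, E). \<forall>S \<subseteq> uncoloured n c. S \<noteq> {} \<longrightarrow>
     real (\<Sum>v\<in>S. degree E v) \<le> real (card S) * avg_bound b n (card S))"

lemma balanced_degree:
  assumes "balanced b n (c, E)" "v \<in> uncoloured n c"
  shows "real (degree E v) \<le> avg_bound b n 1"
proof -
  have "{v} \<subseteq> uncoloured n c" using assms(2) by simp
  then have "real (\<Sum>v\<in>{v}. degree E v) \<le> real (card {v}) * avg_bound b n (card {v})"
    using assms(1) unfolding balanced_def by blast
  then show ?thesis by simp
qed

text \<open>Adding a vertex of maximum degree to a set does not decrease its average degree.\<close>

lemma balanced_round:
  assumes bal: "balanced b n (c, E)" and v: "v \<in> uncoloured n c"
    and max: "\<And>u. u \<in> uncoloured n c \<Longrightarrow> degree E u \<le> degree E v"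
    and F: "F \<subseteq> pairs n" "card F \<le> b"
  shows "balanced b n (c(v \<mapsto> i), E \<union> F)"
  unfolding balanced_def prod.case
proof (intro allI impI)
  fix S assume S: "S \<subseteq> uncoloured n (c(v \<mapsto> i))" "S \<noteq> {}"
  let ?j = "card S"
  have Sv: "S \<subseteq> uncoloured n c" "v \<notin> S" using S by (auto simp: uncoloured_paint)
  have fS: "finite S" using Sv(1) finite_subset by fastforce
  have j0: "?j > 0" using fS S by (simp add: card_gt_0_iff)
  have cvS: "card (insert v S) = Suc ?j" using fS Sv by simp
  have "card (insert v S) \<le> card {1..n}"
    by (intro card_mono) (use Sv v in \<open>auto simp: uncoloured_def\<close>)
  then have jn: "?j < n" using cvS by simp
  let ?s = "real (\<Sum>u\<in>S. degree E u)"
  have "real (\<Sum>u\<in>insert v S. degree E u)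
      \<le> real (card (insert v S)) * avg_bound b n (card (insert v S))"
    using bal Sv(1) v unfolding balanced_def prod.case by (meson insert_not_empty insert_subset)
  then have 1: "?s + degree E v \<le> (real ?j + 1) * avg_bound b n (Suc ?j)"
    using fS Sv cvS by (simp add: add_ac)
  have "(\<Sum>u\<in>S. degree E u) \<le> ?j * degree E v"
    using sum_bounded_above[of S "degree E" "degree E v"] max Sv by auto
  then have 2: "?s \<le> ?j * degree E v" by (metis of_nat_le_iff of_nat_mult)
  \<comment> \<open>Facts 1 and 2 are combined so that \<open>degree E v\<close> is
    eliminated.\<close>
  have "(real ?j + 1) * ?s \<le> ?j * (?s + degree E v)" using 2 by (simp add: algebra_simps)
  also have "\<dots> \<le> ?j * ((real ?j + 1) * avg_bound b n (Suc ?j))"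
    using 1 by (intro mult_left_mono) auto
  finally have "(real ?j + 1) * ?s \<le> (real ?j + 1) * (?j * avg_bound b n (Suc ?j))"
    by (simp add: mult_ac)
  then have 3: "?s \<le> ?j * avg_bound b n (Suc ?j)"
    by (rule mult_left_le_imp_le) simp
  have "(\<Sum>u\<in>S. degree (E \<union> F) u) \<le> (\<Sum>u\<in>S. degree E u) + (\<Sum>u\<in>S. degree F u)"
    by (simp add: sum.distrib[symmetric] sum_mono degree_Un_le)
  also have "\<dots> \<le> (\<Sum>u\<in>S. degree E u) + gain b ?j"
    using sum_degree_le_gain[OF F fS] by simp
  finally have "real (\<Sum>u\<in>S. degree (E \<union> F) u) \<le> ?s + gain b ?j"
    by (metis of_nat_add of_nat_le_iff)
  also have "\<dots> \<le> ?j * avg_bound b n (Suc ?j) + gain b ?j" using 3 by simp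
  also have "\<dots> = ?j * avg_bound b n ?j"
    using j0 jn by (simp add: avg_bound_Suc algebra_simps)
  finally show "real (\<Sum>u\<in>S. degree (E \<union> F) u) \<le> ?j * avg_bound b n ?j" .
qed

lemma painter_legal_exists:
  assumes E: "E \<subseteq> pairs n" and pr: "proper c E" and v: "v \<in> uncoloured n c"
    and deg: "degree E v < k"
  shows "\<exists>i. painter_legal k n (c, E) (v, i)"
proof -
  let ?N = "{w. {v, w} \<in> E}"
  have fE: "finite E" using E finite_pairs finite_subset by blast
  have inj: "inj_on (\<lambda>w. {v, w}) ?N" by (auto simp: inj_on_def doubleton_eq_iff)
  have fin: "finite {e \<in> E. v \<in> e}" using fE by simp
  have sub: "(\<lambda>w. {v, w}) ` ?N \<subseteq> {e \<in> E. v \<in> e}" by auto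
  have fN: "finite ?N" using finite_imageD[OF finite_subset[OF sub fin] inj] .
  have "card ?N \<le> degree E v"
    unfolding degree_def by (rule card_inj_on_le[OF inj sub fin])
  \<comment> \<open>Uncoloured neighbours contribute the unspecified value \<open>the None\<close>;
    this is harmless, as the image still has at most \<open>card ?N\<close> elements.\<close>
  then have "card ((\<lambda>w. the (c w)) ` ?N) < card {1..k}"
    using card_image_le[OF fN, of "\<lambda>w. the (c w)"] deg by simp
  then have "\<not> {1..k} \<subseteq> (\<lambda>w. the (c w)) ` ?N"
    using card_mono[OF finite_imageI[OF fN]] linorder_not_less by blast
  then obtain i where i: "i \<in> {1..k}" "i \<notin> (\<lambda>w. the (c w)) ` ?N" by blast
  have free: "c w \<noteq> Some i" if "{v, w} \<in> E" for w using i(2) that by force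
  have vv: "{v, v} \<notin> E"
  proof
    assume "{v, v} \<in> E"
    then have "{v, v} \<in> pairs n" using E by blast
    then show False using card_pair by force
  qed
  have "proper (c(v \<mapsto> i)) E"
    unfolding proper_def
  proof (intro allI impI, elim conjE)
    fix x y assume xy: "{x, y} \<in> E" "(c(v \<mapsto> i)) x \<noteq> None"
    show "(c(v \<mapsto> i)) x \<noteq> (c(v \<mapsto> i)) y"
    proof (cases "x = v")
      case True
      then show ?thesis using xy vv free[of y] by (auto simp: eq_commute)
    next
      case False
      then show ?thesis
        using xy pr free[of x] unfolding proper_def by (auto simp: insert_commute)
    qed
  qed
  then show ?thesis using i v by (auto simp: painter_legal_def uncoloured_def)
qed

text \<open>This serves the final turn: the graph no longer changes, so the degree bounds persist
  and Painter can colour the vertices one by one.\<close>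

lemma greedy_completable:
  assumes "E \<subseteq> pairs n" "proper c E" "\<And>v. v \<in> uncoloured n c \<Longrightarrow> degree E v < k"
    "ran c \<subseteq> {1..k}"
  shows "completable k n (c, E)"
  using assms(2-4)
proof (induction "card (uncoloured n c)" arbitrary: c)
  case 0
  then have "fully_coloured k n c"
    by (fastforce simp: uncoloured_def fully_coloured_def ran_def)
  then show ?case using 0 unfolding completable_def prod.case by (blast intro: map_le_refl)
next
  case (Suc m)
  then obtain v where v: "v \<in> uncoloured n c"
    by (metis card.empty ex_in_conv nat.distinct(1))
  then obtain i where i: "painter_legal k n (c, E) (v, i)"
    using painter_legal_exists[OF assms(1)] Suc.prems by blast
  have "completable k n (c(v \<mapsto> i), E)"
  proof (rule Suc.hyps(1))
    show "m = card (uncoloured n (c(v \<mapsto> i)))"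
      using Suc.hyps(2) v by (simp add: uncoloured_paint)
    show "ran (c(v \<mapsto> i)) \<subseteq> {1..k}"
      using Suc.prems(3) i v by (auto simp: painter_legal_def uncoloured_def)
  qed (use i Suc.prems in \<open>auto simp: painter_legal_def uncoloured_paint\<close>)
  moreover have "c \<subseteq>\<^sub>m c(v \<mapsto> i)" using v by (auto simp: map_le_def uncoloured_def)
  ultimately show ?case unfolding completable_def prod.case using map_le_trans by blast
qed

section \<open>The maximum-degree strategy\<close>

definition painter_move :: "nat \<Rightarrow> nat \<Rightarrow> position \<Rightarrow> nat \<times> nat \<Rightarrow> bool" where
  "painter_move k n = (\<lambda>p (v, i). painter_legal k n p (v, i) \<and>
     (\<forall>u\<in>uncoloured n (fst p). degree (snd p) u \<le> degree (snd p) v))"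

definition max_degree_strategy :: "nat \<Rightarrow> nat \<Rightarrow> strategy" where
  "max_degree_strategy k n h = (SOME m. painter_move k n (hd h) m)"

definition safe :: "nat \<Rightarrow> nat \<Rightarrow> nat \<Rightarrow> position \<Rightarrow> bool" where
  "safe b k n = (\<lambda>(c, E). E \<subseteq> pairs n \<and> proper c E \<and> ran c \<subseteq> {1..k} \<and> balanced b n (c, E))"

context
  fixes b k n :: nat
  assumes bound: "avg_bound b n 1 < k \<or> n \<le> k"
begin

text \<open>The two alternatives of \<open>bound\<close> match two estimates of a degree: the
  invariant for singletons, and the \<open>n - 1\<close> other vertices.\<close>

lemma safe_degree_less:
  assumes "safe b k n (c, E)" "v \<in> uncoloured n c"
  shows "degree E v < k"
proof -
  have "real (degree E v) \<le> avg_bound b n 1"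
    using assms balanced_degree by (auto simp: safe_def)
  moreover have "degree E v < n"
    using assms degree_less by (auto simp: safe_def uncoloured_def)
  ultimately show ?thesis using bound by linarith
qed

lemma painter_move_max_degree_strategy:
  assumes safe: "safe b k n p" and nf: "\<not> fully_coloured k n (fst p)"
  shows "painter_move k n p (max_degree_strategy k n (p # h))"
proof -
  obtain c E where p: "p = (c, E)" by fastforce
  have "uncoloured n c \<noteq> {}"
    using nf safe by (fastforce simp: p safe_def fully_coloured_def uncoloured_def ran_def)
  then have "Max (degree E ` uncoloured n c) \<in> degree E ` uncoloured n c"
    by (intro Max_in) auto
  then obtain v where v: "v \<in> uncoloured n c" "degree E v = Max (degree E ` uncoloured n c)"
    by force
  have "\<forall>u\<in>uncoloured n c. degree E u \<le> degree E v" unfolding v(2) by simp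
  moreover obtain i where "painter_legal k n (c, E) (v, i)"
    using painter_legal_exists[of E n c v k] safe safe_degree_less[of c E v] v(1)
    by (auto simp: safe_def p)
  ultimately have "painter_move k n p (v, i)" by (simp add: painter_move_def p)
  then show ?thesis unfolding max_degree_strategy_def by (simp add: someI)
qed

text \<open>Assuming \<open>card F \<le> b\<close> instead of equality covers the final turn as
  well, where Builder selects fewer than \<open>b\<close> pairs.\<close>

lemma safe_round:
  assumes safe: "safe b k n p" and move: "painter_move k n p m"
    and F: "F \<subseteq> available n (paint p m)" "card F \<le> b"
  shows "safe b k n (build (paint p m) F)"
proof -
  obtain c E v i where p: "p = (c, E)" "m = (v, i)" by fastforce
  have v: "v \<in> uncoloured n c" "i \<in> {1..k}" "proper (c(v \<mapsto> i)) E"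
    using move by (auto simp: p painter_move_def painter_legal_def uncoloured_def)
  have F': "F \<subseteq> pairs n" using F(1) available_subset_pairs by blast
  have "balanced b n (c(v \<mapsto> i), E \<union> F)"
    using safe move v F' F(2)
    by (intro balanced_round) (auto simp: p safe_def painter_move_def)
  moreover have "proper (c(v \<mapsto> i)) (E \<union> F)"
    using proper_build v(3) F(1) by (auto simp: p paint_def)
  moreover have "ran (c(v \<mapsto> i)) \<subseteq> {1..k}"
    using safe v by (auto simp: p safe_def uncoloured_def)
  ultimately show ?thesis using F' safe by (simp add: p safe_def build_def paint_def)
qed

lemma consistent_safe:
  assumes "consistent b k n (max_degree_strategy k n) h"
  shows "safe b k n (hd h)"
  using assms
proof induction
  case start
  then show ?case
    by (auto simp: safe_def proper_def balanced_def degree_def intro!: mult_nonneg_nonneg avg_bound_nonneg)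
next
  case (round p h q F)
  have "\<not> fully_coloured k n (fst p)"
    using round.hyps(2) not_fully_coloured[of n "fst p" k]
    by (auto simp: painter_legal_def uncoloured_def split: prod.splits)
  then show ?case
    using round painter_move_max_degree_strategy[of p h]
      safe_round[of p "max_degree_strategy k n (p # h)" F]
    by (simp add: builder_legal_def)
qed

lemma winning_max_degree_strategy: "winning_strategy b k n (max_degree_strategy k n)"
  unfolding winning_strategy_def Let_def
proof (intro allI impI, elim conjE)
  fix p h
  let ?m = "max_degree_strategy k n (p # h)"
  let ?q = "paint p ?m"
  assume con: "consistent b k n (max_degree_strategy k n) (p # h)"
    and nf: "\<not> fully_coloured k n (fst p)"
  have safe: "safe b k n p" using consistent_safe[OF con] by simp
  have move: "painter_move k n p ?m" using painter_move_max_degree_strategy safe nf .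
  have "completable k n (build ?q (available n ?q))" if "card (available n ?q) < b"
  proof -
    obtain c E where q: "build ?q (available n ?q) = (c, E)" by fastforce
    have "safe b k n (c, E)" using safe_round[OF safe move subset_refl] that q by simp
    then show ?thesis
      unfolding q using safe_degree_less by (intro greedy_completable) (auto simp: safe_def)
  qed
  then show "painter_legal k n p ?m \<and>
      (card (available n ?q) < b \<longrightarrow> completable k n (build ?q (available n ?q)))"
    using move by (auto simp: painter_move_def split: prod.splits)
qed

end

subsection \<open>Builder's strategy\<close>

definition sees :: "position \<Rightarrow> nat \<Rightarrow> nat \<Rightarrow> bool" where
  "sees = (\<lambda>(c, E) v i. \<exists>w. {v, w} \<in> E \<and> c w = Some i)"

text \<open>Only these vertices can legally receive colour \<open>i\<close>. Builder blocks the
  colour by making this set empty.\<close>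

definition lacking :: "nat \<Rightarrow> position \<Rightarrow> nat \<Rightarrow> nat set" where
  "lacking n p i = {v \<in> uncoloured n (fst p). \<not> sees p v i}"

lemma lacking_build:
  "lacking n (build q F) i \<subseteq> lacking n q i"
  by (auto simp: lacking_def sees_def build_def split: prod.splits)

text \<open>By legality only uncoloured vertices are painted, so a neighbour of colour
  \<open>i\<close> keeps it. Together with \<open>lacking_build\<close> this shows that a blocked
  colour stays blocked.\<close>

lemma lacking_paint:
  assumes "painter_legal k n p m"
  shows "lacking n (paint p m) i \<subseteq> lacking n p i"
  using assms
  by (fastforce simp: lacking_def sees_def paint_def painter_legal_def uncoloured_def split: prod.splits if_splits)

lemma uncoloured_build [simp]: "uncoloured n (fst (build q F)) = uncoloured n (fst q)"
  by (auto simp: build_def split: prod.splits)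

lemma legal_colour_lacking:
  assumes "painter_legal k n (d, E) (v, c)"
  shows "v \<in> lacking n (d, E) c"
proof -
  have v: "v \<in> {1..n}" "d v = None" "proper (d(v \<mapsto> c)) E"
    using assms by (auto simp: painter_legal_def)
  have "\<not> ({v, w} \<in> E \<and> d w = Some c)" for w
  proof
    assume w: "{v, w} \<in> E \<and> d w = Some c"
    then have "w \<noteq> v" using v by auto
    then have "(d(v \<mapsto> c)) v = (d(v \<mapsto> c)) w" using w by simp
    then show False using v(3) w unfolding proper_def by (metis fun_upd_same option.distinct(1))
  qed
  then show ?thesis using v by (auto simp: lacking_def sees_def uncoloured_def)
qed

lemma card_uncoloured_paint:
  assumes "painter_legal k n p m"
  shows "card (uncoloured n (fst p)) = Suc (card (uncoloured n (fst (paint p m))))"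
proof -
  obtain c E v i where p: "p = (c, E)" "m = (v, i)" by fastforce
  have "v \<in> uncoloured n c" using assms by (auto simp: p painter_legal_def uncoloured_def)
  then show ?thesis
    unfolding p paint_def prod.case fst_conv uncoloured_paint by (intro card.remove) simp_all
qed

text \<open>
  After Builder has selected everything, the uncoloured vertices need pairwise distinct colours
  outside \<open>C\<close>.
\<close>

lemma not_completable:
  assumes C: "C \<subseteq> {1..k}" "\<And>i. i \<in> C \<Longrightarrow> lacking n q i = {}"
    and c: "c \<in> {1..k}" "c \<notin> C" "x \<in> {1..n}" "fst q x = Some c"
    and card: "k < card C + 1 + card (uncoloured n (fst q))"
  shows "\<not> completable k n (build q (available n q))"
proof
  obtain d E where q: "q = (d, E)" by fastforce
  let ?U = "uncoloured n d"
  assume "completable k n (build q (available n q))"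
  then obtain d' where d': "d \<subseteq>\<^sub>m d'" "fully_coloured k n d'" "proper d' (E \<union> available n q)"
    by (auto simp: completable_def q build_def)
  have some: "\<exists>i\<in>{1..k}. d' v = Some i" if "v \<in> {1..n}" for v
    using d'(2) that by (auto simp: fully_coloured_def)
  have ext: "d' w = Some i" if "d w = Some i" for w i
    using d'(1) that by (metis domI map_le_def)
  \<comment> \<open>A pair with an uncoloured end is an edge or available, so after the final
    selection \<open>v\<close> is adjacent to all other vertices.\<close>
  have neq: "d' v \<noteq> d' w" if v: "v \<in> ?U" and w: "w \<in> {1..n}" "v \<noteq> w" for v w
  proof -
    have "{v, w} \<in> E \<union> available n q"
      using v w by (auto simp: available_def q uncoloured_def)
    moreover have "d' v \<noteq> None" using some[of v] v by (auto simp: uncoloured_def)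
    ultimately show ?thesis using d'(3) unfolding proper_def by blast
  qed
  have inj: "inj_on (\<lambda>v. the (d' v)) ?U"
  proof (rule inj_onI, rule ccontr)
    fix v w assume vw: "v \<in> ?U" "w \<in> ?U" "the (d' v) = the (d' w)" "v \<noteq> w"
    then have "v \<in> {1..n}" "w \<in> {1..n}" by (auto simp: uncoloured_def)
    then have "d' v = d' w" using some[of v] some[of w] vw(3) by auto
    then show False using neq vw \<open>w \<in> {1..n}\<close> by blast
  qed
  have sub: "(\<lambda>v. the (d' v)) ` ?U \<subseteq> {1..k} - insert c C"
  proof (rule image_subsetI)
    fix v assume v: "v \<in> ?U"
    then have "v \<in> {1..n}" by (simp add: uncoloured_def)
    then obtain i where i: "i \<in> {1..k}" "d' v = Some i" using some by blast
    have "v \<noteq> x" using v c by (auto simp: uncoloured_def q)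
    then have "i \<noteq> c" using neq[OF v c(3)] ext[of x c] c i by (auto simp: q)
    moreover have "i \<notin> C"
    proof
      assume "i \<in> C"
      then have "sees q v i" using C(2)[of i] v by (auto simp: lacking_def q)
      then obtain w where w: "{v, w} \<in> E" "d w = Some i" by (auto simp: sees_def q)
      then have "d' w = d' v" using ext i by auto
      then show False using w d'(3) i unfolding proper_def by (metis UnI1 option.distinct(1))
    qed
    ultimately show "the (d' v) \<in> {1..k} - insert c C" using i by simp
  qed
  have "card ?U \<le> card ({1..k} - insert c C)" by (rule card_inj_on_le[OF inj sub]) simp
  also have "\<dots> = k - Suc (card C)"
    using C(1) c finite_subset[OF C(1)] by (simp add: card_Diff_subset)
  \<comment> \<open>The natural subtraction is exact because \<open>insert c C\<close> lies in
    \<open>{1..k}\<close>.\<close>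
  finally have "card ?U + Suc (card C) \<le> k"
    using card_mono[of "{1..k}" "insert c C"] C(1) c finite_subset[OF C(1)] by auto
  then show False using card by (simp add: q)
qed

section \<open>Builder's play against a supposed winning strategy\<close>

context
  fixes b k n :: nat and \<sigma> :: strategy
  assumes win: "winning_strategy b k n \<sigma>"
begin

lemma painter_legal_strategy:
  assumes "consistent b k n \<sigma> (p # h)" "uncoloured n (fst p) \<noteq> {}"
  shows "painter_legal k n p (\<sigma> (p # h))"
  using win assms not_fully_coloured unfolding winning_strategy_def by blast

text \<open>If fewer than \<open>b\<close> pairs were available, \<open>winning_strategy\<close>
  would make the final position completable, contrary to \<open>nc\<close>. So Builder can pad
  \<open>F0\<close> to exactly \<open>b\<close> edges.\<close>

lemma builder_reply:
  assumes con: "consistent b k n \<sigma> (p # h)" "uncoloured n (fst p) \<noteq> {}"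
    and q: "q = paint p (\<sigma> (p # h))"
    and F0: "F0 \<subseteq> available n q" "card F0 \<le> b"
    and nc: "\<not> completable k n (build q (available n q))"
  shows "\<exists>F. F0 \<subseteq> F \<and> consistent b k n \<sigma> (build q F # p # h)"
proof -
  have "\<not> card (available n q) < b"
    using win con nc not_fully_coloured unfolding winning_strategy_def Let_def q by blast
  then have "\<exists>F. F0 \<subseteq> F \<and> F \<subseteq> available n q \<and> card F = b"
    using exists_subset_between[of F0 b "available n q"] F0 finite_available by force
  then obtain F where F: "F0 \<subseteq> F" "builder_legal b n q F" by (auto simp: builder_legal_def)
  then show ?thesis
    using consistent.round[OF con(1) painter_legal_strategy[OF con] q F(2)] by blast
qed

text \<open>
  Builder joins a fixed vertex \<open>x\<close> of colour \<open>c\<close> to up to \<open>b\<close> vertices lacking \<open>c\<close> in each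
  round; any further edges that he has to select only help him.
\<close>

lemma spread_colour:
  assumes "consistent b k n \<sigma> (p # h)" "uncoloured n (fst p) \<noteq> {}"
    and "q = paint p (\<sigma> (p # h))"
    and C: "C \<subseteq> {1..k}" "\<And>i. i \<in> C \<Longrightarrow> lacking n q i = {}"
    and c: "c \<in> {1..k}" "c \<notin> C" "x \<in> {1..n}" "fst q x = Some c"
    and "card (lacking n q c) \<le> b * Suc t"
    and "s + t \<le> card (uncoloured n (fst q))"
    and s: "s \<ge> 1" "k < card C + 1 + s"
  shows "\<exists>p' h'. consistent b k n \<sigma> (p' # h') \<and> (\<forall>i\<in>insert c C. lacking n p' i = {}) \<and>
           s \<le> card (uncoloured n (fst p'))"
  using assms
proof (induction t arbitrary: p h q)
  case (Suc t p h q)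
  note prems = Suc.prems
  let ?L = "lacking n q c"
  have fL: "finite ?L" by (simp add: lacking_def)
  obtain L0 where L0: "L0 \<subseteq> ?L" "card L0 = min b (card ?L)"
    using obtain_subset_with_card_n[of "min b (card ?L)" ?L] by auto
  define F0 where "F0 = (\<lambda>v. {v, x}) ` L0"
  have "F0 \<subseteq> available n q"
    using L0(1) prems(8,9)
    by (fastforce simp: F0_def available_def lacking_def sees_def uncoloured_def split: prod.splits)
  moreover have "card F0 \<le> b"
    using card_image_le[of L0 "\<lambda>v. {v, x}"] L0 finite_subset[OF L0(1) fL] by (simp add: F0_def)
  \<comment> \<open>This is why \<open>s\<close> is carried along: more vertices are uncoloured than
    there are colours outside \<open>insert c C\<close>.\<close>
  moreover have "\<not> completable k n (build q (available n q))"
    using not_completable[of C k n q c x] prems by auto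
  ultimately obtain F where F: "F0 \<subseteq> F" "consistent b k n \<sigma> (build q F # p # h)"
    using builder_reply[OF prems(1-3)] by blast
  let ?p = "build q F"
  let ?q = "paint ?p (\<sigma> (?p # p # h))"
  have ne: "uncoloured n (fst ?p) \<noteq> {}" using prems(11) by (auto simp: card_gt_0_iff[symmetric])
  have legal: "painter_legal k n ?p (\<sigma> (?p # p # h))"
    using painter_legal_strategy[OF F(2) ne] .
  have "sees ?p v c" if "v \<in> L0" for v
    using F(1) prems(9) that
    by (auto simp: F0_def sees_def build_def image_subset_iff split: prod.splits)
  then have "lacking n ?p c \<subseteq> ?L - L0"
    using lacking_build[of n q F c] by (auto simp: lacking_def)
  then have "card (lacking n ?p c) \<le> card ?L - card L0"
    by (metis L0(1) card_Diff_subset card_mono fL finite_Diff finite_subset)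
  also have "\<dots> \<le> b * Suc t" using L0(2) prems(10) by auto
  finally have Lp: "card (lacking n ?p c) \<le> b * Suc t" .
  show ?case
  \<comment> \<open>Painter's next colour is arbitrary: her move cannot enlarge a
    \<open>lacking\<close> set, uses up one uncoloured vertex and leaves the colour of
    \<open>x\<close> unchanged.\<close>
  proof (rule Suc.IH[OF F(2) ne refl C(1) _ c(1-3)])
    show "card (lacking n ?q c) \<le> b * Suc t"
      using card_mono[OF _ lacking_paint[OF legal, of c]] Lp
      by (simp add: lacking_def)
    show "lacking n ?q i = {}" if "i \<in> C" for i
      using lacking_paint[OF legal, of i] lacking_build[of n q F i] prems(5)[OF that] by blast
    show "fst ?q x = Some c"
      using prems(9) legal by (auto simp: paint_def build_def painter_legal_def split: prod.splits)
    show "s + t \<le> card (uncoloured n (fst ?q))"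
      using card_uncoloured_paint[OF legal] prems(11) by simp
  qed (use prems in auto)
next
  case (0 p h q)
  note prems = "0.prems"
  define F0 where "F0 = (\<lambda>v. {v, x}) ` lacking n q c"
  have "F0 \<subseteq> available n q"
    using prems(8,9)
    by (fastforce simp: F0_def available_def lacking_def sees_def uncoloured_def split: prod.splits)
  moreover have "card F0 \<le> b"
    using card_image_le[of "lacking n q c" "\<lambda>v. {v, x}"] prems(10)
    by (simp add: F0_def lacking_def)
  moreover have "\<not> completable k n (build q (available n q))"
    using not_completable[of C k n q c x] prems by auto
  ultimately obtain F where F: "F0 \<subseteq> F" "consistent b k n \<sigma> (build q F # p # h)"
    using builder_reply[OF prems(1-3)] by blast
  have "lacking n (build q F) c = {}"
    using F(1) prems(9)
    by (fastforce simp: F0_def lacking_def sees_def build_def image_subset_iff split: prod.splits)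
  moreover have "lacking n (build q F) i = {}" if "i \<in> C" for i
    using lacking_build[of n q F i] prems(5)[OF that] by blast
  moreover have "s \<le> card (uncoloured n (fst (build q F)))" using prems(11) by simp
  ultimately show ?case using F(2) by blast
qed

text \<open>All colours in \<open>C\<close> are blocked, so Painter's move opens some
  \<open>c\<close> outside \<open>C\<close>. At most \<open>b * Suc t\<close> uncoloured vertices
  then remain to be joined to it. The \<open>Suc t\<close> rounds, the opening one included, colour
  \<open>Suc t\<close> vertices and leave at least \<open>s\<close>.\<close>

lemma phase:
  assumes con: "consistent b k n \<sigma> (p # h)"
    and C: "C \<subseteq> {1..k}" "\<And>i. i \<in> C \<Longrightarrow> lacking n p i = {}"
    and s: "s + Suc t \<le> card (uncoloured n (fst p))" "s \<ge> 1" "k < card C + 1 + s"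
    and t: "card (uncoloured n (fst p)) \<le> Suc (b * Suc t)"
  shows "\<exists>p' h' c. c \<in> {1..k} - C \<and> consistent b k n \<sigma> (p' # h') \<and>
           (\<forall>i\<in>insert c C. lacking n p' i = {}) \<and> s \<le> card (uncoloured n (fst p'))"
proof -
  have ne: "uncoloured n (fst p) \<noteq> {}" using s by (auto simp: card_gt_0_iff[symmetric])
  obtain d E x c where p: "p = (d, E)" "\<sigma> (p # h) = (x, c)" by fastforce
  have legal: "painter_legal k n p (x, c)" using painter_legal_strategy[OF con ne] p by simp
  let ?q = "paint p (\<sigma> (p # h))"
  have x: "x \<in> {1..n}" "c \<in> {1..k}" using legal by (auto simp: painter_legal_def p)
  have cC: "c \<notin> C" using C(2) legal_colour_lacking legal p by blast
  have qx: "fst ?q x = Some c" unfolding p(2) by (simp add: paint_def p(1))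
  have q: "card (uncoloured n (fst p)) = Suc (card (uncoloured n (fst ?q)))"
    using card_uncoloured_paint legal p(2) by simp
  have Lq: "lacking n ?q i = {}" if "i \<in> C" for i
    using lacking_paint[OF legal, of i] C(2)[OF that] p(2) by simp
  have "card (lacking n ?q c) \<le> card (uncoloured n (fst ?q))"
    by (intro card_mono) (auto simp: lacking_def)
  then have "card (lacking n ?q c) \<le> b * Suc t" using q t by linarith
  moreover have "s + t \<le> card (uncoloured n (fst ?q))" using q s(1) by linarith
  ultimately have "\<exists>p' h'. consistent b k n \<sigma> (p' # h') \<and>
      (\<forall>i\<in>insert c C. lacking n p' i = {}) \<and> s \<le> card (uncoloured n (fst p'))"
    using spread_colour[OF con ne refl C(1) Lq x(2) cC x(1) qx _ _ s(2,3)] by blast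
  then show ?thesis using x(2) cC by blast
qed

text \<open>Induction on the number \<open>j\<close> of open colours. For \<open>j = 0\<close> the
  strategy would have to use a blocked colour. In the step, if the bound failed, a phase would lead
  to a position with one more blocked colour that violates the bound for \<open>j\<close>.\<close>

lemma uncoloured_less_exp:
  assumes b: "b \<ge> 2"
    and "consistent b k n \<sigma> (p # h)" "C \<subseteq> {1..k}" "\<And>i. i \<in> C \<Longrightarrow> lacking n p i = {}"
    and "card C + j = k" "card (uncoloured n (fst p)) \<ge> 1"
  shows "card (uncoloured n (fst p)) + 2 * real b < 2 * real b * exp (2 * real j / b)"
  using assms(2-)
proof (induction j arbitrary: p h C)
  case 0
  have "C = {1..k}" using 0 by (intro card_subset_eq) auto
  moreover have "painter_legal k n p (\<sigma> (p # h))"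
    using 0 by (intro painter_legal_strategy) auto
  moreover obtain d E v c where "p = (d, E)" "\<sigma> (p # h) = (v, c)" by fastforce
  ultimately have "painter_legal k n (d, E) (v, c)" "c \<in> C" "p = (d, E)"
    by (auto simp: painter_legal_def)
  then show ?case using 0(3)[of c] legal_colour_lacking by blast
next
  case (Suc j)
  note prems = Suc.prems
  define m where "m = card (uncoloured n (fst p))"
  show ?case
  proof (rule ccontr)
    assume "\<not> ?thesis"
    then have big: "m + 2 * real b \<ge> 2 * real b * exp (2 * real (Suc j) / b)" by (simp add: m_def)
    have b0: "real b > 0" using b by simp
    \<comment> \<open>This linear bound yields \<open>m \<ge> 4 * Suc j\<close> and later
      \<open>s \<ge> 4 * j\<close>; with \<open>s \<ge> 1\<close> it gives \<open>s > j\<close>, the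
      reserve that \<open>phase\<close> demands.\<close>
    have exp_ge: "2 * real b + 4 * i \<le> 2 * real b * exp (2 * real i / b)" for i :: nat
    proof -
      have "2 * real b + 4 * i = 2 * real b * (1 + 2 * real i / b)" using b0 by (simp add: field_simps)
      also have "\<dots> \<le> 2 * real b * exp (2 * real i / b)"
        by (intro mult_left_mono exp_ge_add_one_self) simp
      finally show ?thesis .
    qed
    have m4: "m \<ge> 4 * Suc j" using big exp_ge[of "Suc j"] by linarith
    \<comment> \<open>\<open>Suc t\<close> is \<open>(m - 1) / b\<close> rounded up, the number of
      rounds needed to reach the \<open>m - 1\<close> vertices left after the opening move.\<close>
    define t where "t = (m - 2) div b"
    define s where "s = m - Suc t"
    have tb: "t * b \<le> m - 2" "m - 2 < Suc t * b"
      using b by (auto simp: t_def dividend_less_div_times add.commute)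
    have tm: "t \<le> m - 2" using tb(1) b by (metis One_nat_def Suc_leD le_trans mult.right_neutral mult_le_mono2 numeral_2_eq_2)
    have sm: "m = s + Suc t" using tm m4 by (simp add: s_def)
    \<comment> \<open>The product \<open>(1 + 2 / b) * (1 - 1 / b)\<close> equals
      \<open>1 + (b - 2) / b^2\<close>, which is at least 1 since \<open>b \<ge> 2\<close>.\<close>
    have e: "exp (2 / b) * (1 - 1 / b) \<ge> 1"
    proof -
      have "(1 + 2 / b) * (1 - 1 / b) \<le> exp (2 / b) * (1 - 1 / real b)"
        using b by (intro mult_right_mono exp_ge_add_one_self) auto
      moreover have "(1 + 2 / b) * (1 - 1 / real b) \<ge> 1"
        using b by (simp add: field_simps)
      ultimately show ?thesis by linarith
    qed
    have "real t * b \<le> real m - 2"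
    proof -
      have "real (t * b) \<le> real (m - 2)" using tb(1) by (simp only: of_nat_le_iff)
      then show ?thesis using m4 by (simp add: of_nat_diff)
    qed
    then have "real s * b \<ge> (m - 1) * real b - (real m - 2)"
      using m4 by (simp add: sm algebra_simps)
    \<comment> \<open>Shifting \<open>s\<close> and \<open>m\<close> by \<open>2 * b\<close> turns
      the loss of a phase into the pure factor \<open>1 - 1 / b\<close>; the summand
      \<open>b\<close> is slack.\<close>
    then have "(s + 2 * real b) * b \<ge> (m + 2 * real b) * (real b - 1) + b"
      using m4 by (simp add: algebra_simps)
    then have "s + 2 * real b \<ge> (m + 2 * real b) * (1 - 1 / b)"
      using b0 by (simp add: field_simps)
    moreover have "(m + 2 * real b) * (1 - 1 / b) \<ge> 2 * real b * exp (2 * real (Suc j) / b) * (1 - 1 / b)"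
      using big b by (intro mult_right_mono) auto
    moreover have "exp (2 * real (Suc j) / b) = exp (2 * real j / b) * exp (2 / b)"
      by (simp add: exp_add[symmetric] add_divide_distrib)
    moreover have "2 * real b * exp (2 * real j / b) * (exp (2 / b) * (1 - 1 / b))
        \<ge> 2 * real b * exp (2 * real j / b) * 1"
      using e by (intro mult_left_mono) auto
    ultimately have s: "s + 2 * real b \<ge> 2 * real b * exp (2 * real j / b)"
      by (simp add: mult.assoc)
    have s4: "s \<ge> 4 * j" using s exp_ge[of j] by linarith
    have s1: "s \<ge> 1" using sm tm m4 by presburger
    have "k < card C + 1 + s" using s1 s4 prems(4) by linarith
    moreover have "m \<le> Suc (b * Suc t)" using tb(2) m4 by (simp only: mult.commute)
    ultimately have "\<exists>p' h' c. c \<in> {1..k} - C \<and> consistent b k n \<sigma> (p' # h') \<and>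
        (\<forall>i\<in>insert c C. lacking n p' i = {}) \<and> s \<le> card (uncoloured n (fst p'))"
      using sm s1 unfolding m_def by (intro phase[OF prems(1-3)]) simp_all
    then obtain p' h' c where p': "c \<in> {1..k} - C" "consistent b k n \<sigma> (p' # h')"
      "\<forall>i\<in>insert c C. lacking n p' i = {}" "s \<le> card (uncoloured n (fst p'))"
      by blast
    have fC: "finite C" using prems(2) finite_subset by blast
    have "card (uncoloured n (fst p')) + 2 * real b < 2 * real b * exp (2 * real j / b)"
    proof (rule Suc.IH[OF p'(2), of "insert c C"])
      show "card (insert c C) + j = k" using prems(4) p'(1) fC by simp
    qed (use p' prems s1 in auto)
    then show False using s p'(4) by linarith
  qed
qed

end

section \<open>The two bounds on \<open>k_min\<close>\<close>

lemma winning_strategy_lower_bound: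
  assumes "winning_strategy b k n \<sigma>" "b \<ge> 2" "n \<ge> 1"
  shows "real b / 2 * ln (real n / (2 * real b) + 1) < real k"
proof -
  have "uncoloured n (\<lambda>_. None) = {1..n}" by (auto simp: uncoloured_def)
  \<comment> \<open>At the start no colour is blocked, so \<open>C\<close> is empty and all
    \<open>k\<close> colours are open.\<close>
  then have "n + 2 * real b < 2 * real b * exp (2 * real k / b)"
    using uncoloured_less_exp[OF assms(1,2) consistent.start, of "{}" k] assms by simp
  then have "n / (2 * real b) + 1 < exp (2 * real k / b)"
    using assms by (simp add: field_simps)
  then have "ln (n / (2 * real b) + 1) < 2 * real k / b"
    by (metis add_nonneg_pos divide_nonneg_nonneg exp_gt_zero ln_exp ln_less_cancel_iff mult_nonneg_nonneg of_nat_0_le_iff zero_le_numeral zero_less_one)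
  then show ?thesis using assms by (simp add: field_simps)
qed

theorem theorem5:
  fixes b n :: nat
  assumes "b \<ge> 2" and "n \<ge> 2"
  shows "real b / 2 * ln (real n / (2 * real b) + 1) < real (k_min b n) \<and>
         int (k_min b n) \<le> min \<lceil>2 * real b * ln (real n)\<rceil> (int n)"
proof -
  let ?P = "\<lambda>k. 0 < k \<and> (\<exists>\<sigma>. winning_strategy b k n \<sigma>)"
  have pos: "2 * real b * ln (real n) > 0" using assms by simp
  define k where "k = nat \<lceil>2 * real b * ln (real n)\<rceil>"
  have k: "int k = \<lceil>2 * real b * ln (real n)\<rceil>" using pos by (simp add: k_def)
  have "avg_bound b n 1 < k" using avg_bound_less[OF assms] unfolding k_def by linarith
  moreover have "k > 0" using pos by (simp add: k_def)
  ultimately have k_win: "?P k" using winning_max_degree_strategy by blast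
  \<comment> \<open>With \<open>n\<close> colours the second alternative of \<open>bound\<close>
    holds. This also guarantees that the \<open>LEAST\<close> in \<open>k_min\<close> is
    attained.\<close>
  have n_win: "?P n" using winning_max_degree_strategy[of b n n] assms by auto
  have "?P (k_min b n)" unfolding k_min_def by (rule LeastI[of ?P, OF n_win])
  then have "real b / 2 * ln (real n / (2 * real b) + 1) < real (k_min b n)"
    using winning_strategy_lower_bound assms by auto
  moreover have "k_min b n \<le> k" "k_min b n \<le> n"
    unfolding k_min_def using k_win n_win by (auto intro: Least_le)
  ultimately show ?thesis using k by simp
qed

end
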